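(* The set of identities $\{u_n\approx v_n\mid n\ge 2\}$ defines the variety $\mathbf{SPS}$ of strict pseudosemilattices within the variety $\mathbf{PS}$ of all pseudosemilattices; that is, a pseudosemilattice belongs to $\mathbf{SPS}$ if and only if it satisfies $u_n\approx v_n$ for all $n\ge 2$.
   Context: A pseudosemilattice is a set with a binary operation $\wedge$ satisfying the identities (PS1) $x\wedge x\approx x$; (PS2) $(x\wedge y)\wedge(x\wedge z)\approx(x\wedge y)\wedge z$; (PS3) $((x\wedge y)\wedge(x\wedge z))\wedge(x\wedge w)\approx(x\wedge y)\wedge((x\wedge z)\wedge(x\wedge w))$; and the left-right duals (PS2') $(z\wedge x)\wedge(y\wedge x)\approx z\wedge(y\wedge x)$ and (PS3') $(w\wedge x)\wedge((z\wedge x)\wedge(y\wedge x))\approx((w\wedge x)\wedge(z\wedge x))\wedge(y\wedge x)$. $\mathbf{PS}$ is the variety of all pseudosemilattices. $\mathbf{SPS}$ is the variety generated by the pseudosemilattice $E_2$ of idempotents of the five-element combinatorial non-orthodox completely $0$-simple semigroup $A_2$. Explicitly, $E_2=\{0,e_{11},e_{12},e_{21}\}$ where $0$ is absorbing for $\wedge$ and $e_{i\lambda}\wedge e_{j\mu}=e_{i\mu}$ if $(i,\mu)\neq(2,2)$, while $e_{i\lambda}\wedge e_{j\mu}=0$ if $(i,\mu)=(2,2)$. It is the unique least non-associative variety of pseudosemilattices. For $n\ge2$ let $x_1,\dots,x_{2n}$ be pairwise distinct variables. Define words (terms in $\wedge$) $w_{2n},w_{2n-1},\dots,w_2$ by $w_{2n}=x_1\wedge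 x_{2n}$ and, for $2\le i<2n$, $w_i=x_i\wedge w_{i+1}$ if $i$ is odd and $w_i=w_{i+1}\wedge x_i$ if $i$ is even. Then $u_n=x_1\wedge w_2$ and $v_n=(x_1\wedge x_{2n})\wedge w_2$. (In the tree representation of words these are the unique words represented by the paths with label sequence $x_1,x_2,\dots,x_{2n},x_1$, respectively $x_{2n},x_1,x_2,\dots,x_{2n},x_1$, whose left root is the first vertex labelled $x_1$ and whose right root is the vertex labelled $x_2$.) *)

theory Defs
  imports Main
begin

datatype 'v trm = Var 'v | Meet "'v trm" "'v trm"  (infix \<open>\<curlywedge>\<close> 70)

type_synonym 'a magma = "'a set \<times> ('a \<Rightarrow> 'a \<Rightarrow> 'a)"

text \<open>Every identity involves only finitely many variables, so variables drawn from
  \<^typ>\<open>nat\<close> suffice for arbitrary identities.\<close>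

type_synonym ident = "nat trm \<times> nat trm"

primrec eval :: "('a \<Rightarrow> 'a \<Rightarrow> 'a) \<Rightarrow> ('v \<Rightarrow> 'a) \<Rightarrow> 'v trm \<Rightarrow> 'a" where
  "eval m \<rho> (Var x) = \<rho> x"
| "eval m \<rho> (s \<curlywedge> t) = m (eval m \<rho> s) (eval m \<rho> t)"

definition satisfies :: "'a magma \<Rightarrow> ident \<Rightarrow> bool" where
  "satisfies = (\<lambda>(A, m) (s, t). \<forall>\<rho>. range \<rho> \<subseteq> A \<longrightarrow> eval m \<rho> s = eval m \<rho> t)"

definition equational_class :: "ident set \<Rightarrow> 'a magma set" where
  "equational_class \<Sigma> =
     {(A, m). (\<forall>a\<in>A. \<forall>b\<in>A. m a b \<in> A) \<and> (\<forall>e\<in>\<Sigma>. satisfies (A, m) e)}"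

text \<open>A variety is an equational class, and the variety generated by a magma is the
  intersection of all varieties containing it. Its members may live on a type different from
  that of the generator, so the varieties are represented by their defining sets of
  identities.\<close>

definition generated_variety :: "'b magma \<Rightarrow> 'a magma set" where
  "generated_variety B = \<Inter> {equational_class \<Sigma> | \<Sigma>. B \<in> equational_class \<Sigma>}"

definition PS_identities :: "ident set" where
  "PS_identities =
    (let x = Var 0; y = Var 1; z = Var 2; w = Var 3 in
     {(x \<curlywedge> x, x),
      ((x \<curlywedge> y) \<curlywedge> (x \<curlywedge> z), (x \<curlywedge> y) \<curlywedge> z),
      (((x \<curlywedge> y) \<curlywedge> (x \<curlywedge> z)) \<curlywedge> (x \<curlywedge> w), (x \<curlywedge> y) \<curlywedge> ((x \<curlywedge> z) \<curlywedge> (x \<curlywedge> w))),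
      ((z \<curlywedge> x) \<curlywedge> (y \<curlywedge> x), z \<curlywedge> (y \<curlywedge> x)),
      ((w \<curlywedge> x) \<curlywedge> ((z \<curlywedge> x) \<curlywedge> (y \<curlywedge> x)), ((w \<curlywedge> x) \<curlywedge> (z \<curlywedge> x)) \<curlywedge> (y \<curlywedge> x))})"

definition PS :: "'a magma set" where
  "PS = equational_class PS_identities"

datatype e2 = Zero | E nat nat

fun meet_E2 :: "e2 \<Rightarrow> e2 \<Rightarrow> e2" where
  "meet_E2 (E i l) (E j k) = (if (i, k) = (2, 2) then Zero else E i k)"
| "meet_E2 _ _ = Zero"

definition E2 :: "e2 magma" where
  "E2 = ({Zero, E 1 1, E 1 2, E 2 1}, meet_E2)"

definition SPS :: "'a magma set" where
  "SPS = generated_variety E2"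

text \<open>\<open>word_w n i\<close> is the word $w_i$ belonging to the parameter \<open>n\<close>, for
  \<open>2 \<le> i \<le> 2 * n\<close>; other values of \<open>i\<close> are irrelevant.\<close>

function word_w :: "nat \<Rightarrow> nat \<Rightarrow> nat trm" where
  "word_w n i =
    (if 2 * n \<le> i then Var 1 \<curlywedge> Var (2 * n)
     else if odd i then Var i \<curlywedge> word_w n (i + 1)
     else word_w n (i + 1) \<curlywedge> Var i)"
  by pat_completeness auto
termination by (relation "measure (\<lambda>(n, i). 2 * n - i)") auto

text \<open>The recursion equation would make the simplifier loop.\<close>

declare word_w.simps [simp del]

definition word_u :: "nat \<Rightarrow> nat trm" where
  "word_u n = Var 1 \<curlywedge> word_w n 2"

definition word_v :: "nat \<Rightarrow> nat trm" where
  "word_v n = (Var 1 \<curlywedge> Var (2 * n)) \<curlywedge> word_w n 2"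

end

theory Submission
  imports Defs
begin

text \<open>
  For a term \<open>t\<close>, let \<open>edges t\<close> be the set of all pairs (first variable, last variable) of
  subterms of \<open>t\<close>.  Since \<open>E2\<close> is a rectangular band with one cell replaced by zero, a term is
  nonzero there exactly if \<open>x \<and> y\<close> is nonzero for each edge \<open>(x, y)\<close>, and its value is then the
  product of its first and its last variable.  Hence \<open>E2\<close> satisfies \<open>s \<approx> t\<close> if and only if \<open>s\<close> and
  \<open>t\<close> have the same first variable, the same last variable and the same edges
  (\<open>E2_satisfies_iff\<close>).  The words \<open>u\<^sub>n\<close> and \<open>v\<^sub>n\<close> meet this condition, since the edges of the
  factor \<open>x\<^sub>1 \<and> x\<^bsub>2n\<^esub>\<close> of \<open>v\<^sub>n\<close> already come from the same word inside \<open>w\<^sub>2\<close>.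

  For the converse, two preorders govern a pseudosemilattice: \<open>a \<le>\<^sub>R x\<close> if \<open>x \<and> a = a\<close> and
  \<open>a \<le>\<^sub>L x\<close> if \<open>a \<and> x = a\<close>.  An element is below \<open>x \<and> y\<close> (in both preorders) exactly if it is
  \<open>\<le>\<^sub>R x\<close> and \<open>\<le>\<^sub>L y\<close>.  Let \<open>D\<close> be the equivalence relation generated by the equivalences \<open>R\<close> and
  \<open>L\<close> of the two preorders.  The identities \<open>u\<^sub>n \<approx> v\<^sub>n\<close> imply that every \<open>D\<close>-class contains at
  most one element below a given \<open>x\<close> (\<open>D_majorization\<close>): if \<open>e\<close> and \<open>f\<close> are two such elements,
  substitute \<open>x\<close> for \<open>x\<^sub>1\<close> and a zigzag of \<open>R\<close>- and \<open>L\<close>-steps from \<open>e\<close> to \<open>f\<close> for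
  \<open>x\<^sub>2, \<dots>, x\<^bsub>2n\<^esub>\<close>; then \<open>e\<close> is below \<open>u\<^sub>n = v\<^sub>n\<close>, whose left factor is \<open>x \<and> f = f\<close>, so that
  \<open>e \<le>\<^sub>R f\<close>.  By symmetry \<open>e\<close> and \<open>f\<close> are \<open>R\<close>-equivalent, and this forces \<open>e = f\<close> below \<open>x\<close>.

  So each \<open>D\<close>-class sees the algebra as a rectangular band with zeros, in the way \<open>E2\<close> does:
  an element \<open>e\<close> of a \<open>D\<close>-class lies below the value of \<open>t\<close> if and only if it lies below the
  product of the first and the last variable, and the class has elements below \<open>x \<and> y\<close> for
  each edge \<open>(x, y)\<close> (\<open>below_eval_iff\<close>).  Consequently terms with equal invariants have the
  same lower bounds, hence the same value.
\<close>

section \<open>Identities of the four-element generator\<close>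

primrec first_var :: "'v trm \<Rightarrow> 'v" where
  "first_var (Var x) = x"
| "first_var (s \<curlywedge> t) = first_var s"

primrec last_var :: "'v trm \<Rightarrow> 'v" where
  "last_var (Var x) = x"
| "last_var (s \<curlywedge> t) = last_var t"

primrec edges :: "'v trm \<Rightarrow> ('v \<times> 'v) set" where
  "edges (Var x) = {(x, x)}"
| "edges (s \<curlywedge> t) = insert (first_var s, last_var t) (edges s \<union> edges t)"

lemma first_last_in_edges: "(first_var t, last_var t) \<in> edges t"
  by (cases t) auto

lemma loops_in_edges: "(x, y) \<in> edges t \<Longrightarrow> (x, x) \<in> edges t \<and> (y, y) \<in> edges t"
proof (induction t)
  case (Meet s t)
  have "(first_var s, first_var s) \<in> edges s" for s :: "'a trm"
    by (induction s) auto
  moreover have "(last_var s, last_var s) \<in> edges s" for s :: "'a trm"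
    by (induction s) auto
  ultimately show ?case
    using Meet by auto
qed auto

lemma E2_closed: "a \<in> fst E2 \<Longrightarrow> b \<in> fst E2 \<Longrightarrow> meet_E2 a b \<in> fst E2"
  by (auto simp: E2_def)

lemma E2_meet_meet:
  assumes "a \<in> fst E2" "b \<in> fst E2" "c \<in> fst E2" "d \<in> fst E2"
    and "meet_E2 a b \<noteq> Zero" "meet_E2 c d \<noteq> Zero"
  shows "meet_E2 (meet_E2 a b) (meet_E2 c d) = meet_E2 a d"
  using assms by (auto simp: E2_def)

lemma eval_E2:
  assumes "range \<rho> \<subseteq> fst E2"
  shows "eval meet_E2 \<rho> t =
    (if \<forall>(x, y)\<in>edges t. meet_E2 (\<rho> x) (\<rho> y) \<noteq> Zero
     then meet_E2 (\<rho> (first_var t)) (\<rho> (last_var t)) else Zero)"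
proof (induction t)
  case (Var x)
  have "\<rho> x \<in> fst E2"
    using assms by auto
  then show ?case
    by (auto simp: E2_def)
next
  case (Meet s t)
  have \<rho>: "\<rho> x \<in> fst E2" for x
    using assms by auto
  have meet: "meet_E2 (\<rho> a) (\<rho> b) \<noteq> Zero \<Longrightarrow> meet_E2 (\<rho> c) (\<rho> d) \<noteq> Zero \<Longrightarrow>
      meet_E2 (meet_E2 (\<rho> a) (\<rho> b)) (meet_E2 (\<rho> c) (\<rho> d)) = meet_E2 (\<rho> a) (\<rho> d)" for a b c d
    by (rule E2_meet_meet[OF \<rho> \<rho> \<rho> \<rho>])
  have zero: "meet_E2 a Zero = Zero" for a
    by (cases a) auto
  show ?case
  proof (cases "\<forall>(x, y)\<in>edges s \<union> edges t. meet_E2 (\<rho> x) (\<rho> y) \<noteq> Zero")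
    case True
    then have "meet_E2 (\<rho> (first_var s)) (\<rho> (last_var s)) \<noteq> Zero"
      "meet_E2 (\<rho> (first_var t)) (\<rho> (last_var t)) \<noteq> Zero"
      using first_last_in_edges[of s] first_last_in_edges[of t] by auto
    from meet[OF this] show ?thesis
      using Meet.IH True by auto
  next
    case False
    then have "eval meet_E2 \<rho> (s \<curlywedge> t) = Zero"
      using Meet.IH by (auto simp: zero split_beta split: if_splits)
    then show ?thesis
      using False by auto
  qed
qed

lemma eval_E2_eq_Zero_iff:
  assumes "range \<rho> \<subseteq> fst E2"
  shows "eval meet_E2 \<rho> t = Zero \<longleftrightarrow> (\<exists>x y. (x, y) \<in> edges t \<and> meet_E2 (\<rho> x) (\<rho> y) = Zero)"
  unfolding eval_E2[OF assms] using first_last_in_edges[of t] by auto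

text \<open>By \<open>eval_E2\<close> the value of a term depends only on the three invariants.  Conversely, each of
  them can be read off: a loop \<open>(x, x)\<close> by making \<open>x\<close> zero, an edge \<open>(x, y)\<close> with \<open>x \<noteq> y\<close> by
  assigning to \<open>x\<close> and \<open>y\<close> the two nonzero elements whose product is zero, and the first and the
  last variable by giving that variable another row or column than all the others.\<close>

lemma E2_satisfies_iff:
  "satisfies E2 (s, t) \<longleftrightarrow>
    first_var s = first_var t \<and> last_var s = last_var t \<and> edges s = edges t"
proof
  assume "satisfies E2 (s, t)"
  then have eq: "eval meet_E2 \<rho> s = eval meet_E2 \<rho> t" if "range \<rho> \<subseteq> fst E2" for \<rho>
    using that by (auto simp: satisfies_def E2_def)
  have edge: "(x, y) \<in> edges t'"
    if xy: "(x, y) \<in> edges s'"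
      and eq': "\<And>\<rho>. range \<rho> \<subseteq> fst E2 \<Longrightarrow> eval meet_E2 \<rho> s' = eval meet_E2 \<rho> t'"
    for x y :: nat and s' t' :: "nat trm"
  proof (rule ccontr)
    assume no: "(x, y) \<notin> edges t'"
    show False
    proof (cases "x = y")
      case True
      define \<rho> where "\<rho> = (\<lambda>z. E 1 1)(x := Zero)"
      have \<rho>: "range \<rho> \<subseteq> fst E2"
        by (auto simp: \<rho>_def E2_def)
      have "eval meet_E2 \<rho> s' = Zero"
        unfolding eval_E2_eq_Zero_iff[OF \<rho>] using xy True
        by (intro exI[of _ x] exI[of _ y]) (simp add: \<rho>_def)
      moreover have "x \<noteq> a \<and> x \<noteq> b" if "(a, b) \<in> edges t'" for a b
        using no True loops_in_edges[OF that] by auto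
      then have "eval meet_E2 \<rho> t' \<noteq> Zero"
        unfolding eval_E2_eq_Zero_iff[OF \<rho>] by (auto simp: \<rho>_def)
      ultimately show False
        using eq'[OF \<rho>] by simp
    next
      case False
      define \<rho> where "\<rho> = (\<lambda>z. E 1 1)(x := E 2 1, y := E 1 2)"
      have \<rho>: "range \<rho> \<subseteq> fst E2"
        by (auto simp: \<rho>_def E2_def)
      have "eval meet_E2 \<rho> s' = Zero"
        unfolding eval_E2_eq_Zero_iff[OF \<rho>] using xy False
        by (intro exI[of _ x] exI[of _ y]) (simp add: \<rho>_def)
      moreover have "meet_E2 (\<rho> a) (\<rho> b) \<noteq> Zero" if "(a, b) \<in> edges t'" for a b
        using no that False by (auto simp: \<rho>_def)
      then have "eval meet_E2 \<rho> t' \<noteq> Zero"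
        unfolding eval_E2_eq_Zero_iff[OF \<rho>] by blast
      ultimately show False
        using eq'[OF \<rho>] by simp
    qed
  qed
  have "edges s = edges t"
    using edge[of _ _ s t] edge[of _ _ t s] eq by auto
  moreover have "first_var s = first_var t"
  proof (rule ccontr)
    assume no: "first_var s \<noteq> first_var t"
    define \<rho> where "\<rho> = (\<lambda>z. E 1 1)(first_var s := E 2 1)"
    have \<rho>: "range \<rho> \<subseteq> fst E2"
      by (auto simp: \<rho>_def E2_def)
    have "meet_E2 (\<rho> a) (\<rho> b) \<noteq> Zero" for a b
      by (auto simp: \<rho>_def)
    then show False
      using eq[OF \<rho>] no unfolding eval_E2[OF \<rho>] by (auto simp: \<rho>_def split: if_splits)
  qed
  moreover have "last_var s = last_var t"
  proof (rule ccontr)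
    assume no: "last_var s \<noteq> last_var t"
    define \<rho> where "\<rho> = (\<lambda>z. E 1 1)(last_var s := E 1 2)"
    have \<rho>: "range \<rho> \<subseteq> fst E2"
      by (auto simp: \<rho>_def E2_def)
    have "meet_E2 (\<rho> a) (\<rho> b) \<noteq> Zero" for a b
      by (auto simp: \<rho>_def)
    then show False
      using eq[OF \<rho>] no unfolding eval_E2[OF \<rho>] by (auto simp: \<rho>_def split: if_splits)
  qed
  ultimately show "first_var s = first_var t \<and> last_var s = last_var t \<and> edges s = edges t"
    by simp
next
  assume "first_var s = first_var t \<and> last_var s = last_var t \<and> edges s = edges t"
  then have "eval meet_E2 \<rho> s = eval meet_E2 \<rho> t" if "range \<rho> \<subseteq> fst E2" for \<rho>
    using eval_E2[OF that, of s] eval_E2[OF that, of t] by simp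
  then show "satisfies E2 (s, t)"
    by (auto simp: satisfies_def E2_def)
qed

lemma word_w_last: "word_w n (2 * n) = Var 1 \<curlywedge> Var (2 * n)"
  by (subst word_w.simps) simp

lemma word_w_odd: "odd i \<Longrightarrow> i < 2 * n \<Longrightarrow> word_w n i = Var i \<curlywedge> word_w n (i + 1)"
  by (subst word_w.simps) simp

lemma word_w_even: "even i \<Longrightarrow> i < 2 * n \<Longrightarrow> word_w n i = word_w n (i + 1) \<curlywedge> Var i"
  by (subst word_w.simps) simp

text \<open>The innermost word \<open>x\<^sub>1 \<and> x\<^bsub>2n\<^esub>\<close> is also the additional factor by which \<open>v\<^sub>n\<close> differs
  from \<open>u\<^sub>n\<close>.\<close>

lemma edges_word_w_last: "i \<le> 2 * n \<Longrightarrow> edges (word_w n (2 * n)) \<subseteq> edges (word_w n i)"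
proof (induction rule: inc_induct)
  case (step i)
  then show ?case
    by (cases "odd i") (auto simp: word_w_odd word_w_even)
qed simp

lemma E2_in_PS: "E2 \<in> PS"
proof -
  have "satisfies E2 e" if "e \<in> PS_identities" for e
    using that by (auto simp: PS_identities_def Let_def E2_satisfies_iff)
  then show ?thesis
    using E2_closed by (auto simp: PS_def equational_class_def E2_def)
qed

lemma E2_satisfies_word_u_v:
  assumes "2 \<le> n"
  shows "satisfies E2 (word_u n, word_v n)"
  unfolding E2_satisfies_iff
  using edges_word_w_last[of 2 n] assms
  by (auto simp: word_u_def word_v_def word_w_last)

section \<open>The two preorders of a pseudosemilattice\<close>

locale pseudosemilattice =
  fixes A :: "'a set" and m :: "'a \<Rightarrow> 'a \<Rightarrow> 'a"  (infixl \<open>\<sqinter>\<close> 70)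
  assumes closed [simp]: "x \<in> A \<Longrightarrow> y \<in> A \<Longrightarrow> x \<sqinter> y \<in> A"
    and PS1: "x \<in> A \<Longrightarrow> x \<sqinter> x = x"
    and PS2: "\<lbrakk>x \<in> A; y \<in> A; z \<in> A\<rbrakk> \<Longrightarrow> (x \<sqinter> y) \<sqinter> (x \<sqinter> z) = (x \<sqinter> y) \<sqinter> z"
    and PS3: "\<lbrakk>x \<in> A; y \<in> A; z \<in> A; w \<in> A\<rbrakk> \<Longrightarrow>
      ((x \<sqinter> y) \<sqinter> (x \<sqinter> z)) \<sqinter> (x \<sqinter> w) = (x \<sqinter> y) \<sqinter> ((x \<sqinter> z) \<sqinter> (x \<sqinter> w))"
    and PS2': "\<lbrakk>x \<in> A; y \<in> A; z \<in> A\<rbrakk> \<Longrightarrow> (z \<sqinter> x) \<sqinter> (y \<sqinter> x) = z \<sqinter> (y \<sqinter> x)"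
    and PS3': "\<lbrakk>x \<in> A; y \<in> A; z \<in> A; w \<in> A\<rbrakk> \<Longrightarrow>
      (w \<sqinter> x) \<sqinter> ((z \<sqinter> x) \<sqinter> (y \<sqinter> x)) = ((w \<sqinter> x) \<sqinter> (z \<sqinter> x)) \<sqinter> (y \<sqinter> x)"

lemma pseudosemilattice_if_PS:
  assumes "(A, m) \<in> PS"
  shows "pseudosemilattice A m"
proof -
  have closed: "m a b \<in> A" if "a \<in> A" "b \<in> A" for a b
    using assms that by (auto simp: PS_def equational_class_def)
  have sat: "eval m \<rho> s = eval m \<rho> t" if "(s, t) \<in> PS_identities" "range \<rho> \<subseteq> A" for s t \<rho>
    using assms that by (auto simp: PS_def equational_class_def satisfies_def)
  show ?thesis
  proof
    fix x y z w assume xyzw: "x \<in> A" "y \<in> A" "z \<in> A" "w \<in> A"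
    define \<rho> where "\<rho> = (\<lambda>i::nat. x)(1 := y, 2 := z, 3 := w)"
    have "range \<rho> \<subseteq> A"
      using xyzw by (auto simp: \<rho>_def)
    note sat = sat[OF _ this]
    let ?x = "Var 0 :: nat trm" and ?y = "Var 1 :: nat trm"
      and ?z = "Var 2 :: nat trm" and ?w = "Var 3 :: nat trm"
    show "m (m (m x y) (m x z)) (m x w) = m (m x y) (m (m x z) (m x w))"
      using sat[of "((?x \<curlywedge> ?y) \<curlywedge> (?x \<curlywedge> ?z)) \<curlywedge> (?x \<curlywedge> ?w)"
          "(?x \<curlywedge> ?y) \<curlywedge> ((?x \<curlywedge> ?z) \<curlywedge> (?x \<curlywedge> ?w))"]
      by (simp add: PS_identities_def Let_def \<rho>_def)
    show "m (m w x) (m (m z x) (m y x)) = m (m (m w x) (m z x)) (m y x)"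
      using sat[of "(?w \<curlywedge> ?x) \<curlywedge> ((?z \<curlywedge> ?x) \<curlywedge> (?y \<curlywedge> ?x))"
          "((?w \<curlywedge> ?x) \<curlywedge> (?z \<curlywedge> ?x)) \<curlywedge> (?y \<curlywedge> ?x)"]
      by (simp add: PS_identities_def Let_def \<rho>_def)
  next
    fix x y z assume xyz: "x \<in> A" "y \<in> A" "z \<in> A"
    define \<rho> where "\<rho> = (\<lambda>i::nat. x)(1 := y, 2 := z)"
    have "range \<rho> \<subseteq> A"
      using xyz by (auto simp: \<rho>_def)
    note sat = sat[OF _ this]
    let ?x = "Var 0 :: nat trm" and ?y = "Var 1 :: nat trm" and ?z = "Var 2 :: nat trm"
    show "m (m x y) (m x z) = m (m x y) z"
      using sat[of "(?x \<curlywedge> ?y) \<curlywedge> (?x \<curlywedge> ?z)" "(?x \<curlywedge> ?y) \<curlywedge> ?z"]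
      by (simp add: PS_identities_def Let_def \<rho>_def)
    show "m (m z x) (m y x) = m z (m y x)"
      using sat[of "(?z \<curlywedge> ?x) \<curlywedge> (?y \<curlywedge> ?x)" "?z \<curlywedge> (?y \<curlywedge> ?x)"]
      by (simp add: PS_identities_def Let_def \<rho>_def)
  next
    fix x assume "x \<in> A"
    then show "m x x = x"
      using sat[of "Var 0 \<curlywedge> Var 0" "Var 0" "\<lambda>_. x"]
      by (auto simp: PS_identities_def Let_def)
  qed (rule closed)
qed

context pseudosemilattice
begin

lemma dual: "pseudosemilattice A (\<lambda>a b. b \<sqinter> a)"
  by unfold_locales (assumption | rule closed PS1 PS2 PS2' PS3 PS3')+

lemma eval_closed: "range \<rho> \<subseteq> A \<Longrightarrow> eval m \<rho> t \<in> A"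
  by (induction t) auto

text \<open>The preorders are abbreviations, so that the dual of a lemma is again stated in terms of
  them, with their roles exchanged.\<close>

abbreviation le_R :: "'a \<Rightarrow> 'a \<Rightarrow> bool"  (infix \<open>\<le>\<^sub>R\<close> 50) where
  "a \<le>\<^sub>R x \<equiv> x \<sqinter> a = a"

abbreviation le_L :: "'a \<Rightarrow> 'a \<Rightarrow> bool"  (infix \<open>\<le>\<^sub>L\<close> 50) where
  "a \<le>\<^sub>L x \<equiv> a \<sqinter> x = a"

abbreviation below :: "'a \<Rightarrow> 'a \<Rightarrow> bool"  (infix \<open>\<preceq>\<close> 50) where
  "a \<preceq> x \<equiv> a \<le>\<^sub>R x \<and> a \<le>\<^sub>L x"

lemma below_antisym: "a \<preceq> b \<Longrightarrow> b \<preceq> a \<Longrightarrow> a = b"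
  by simp

lemma meet_le_R: "x \<in> A \<Longrightarrow> y \<in> A \<Longrightarrow> x \<sqinter> y \<le>\<^sub>R x"
  using PS2[of x x y] by (simp add: PS1)

lemma meet_le_L: "x \<in> A \<Longrightarrow> y \<in> A \<Longrightarrow> x \<sqinter> y \<le>\<^sub>L y"
  using pseudosemilattice.meet_le_R[OF dual] by blast

lemma le_R_assoc:
  assumes "a \<in> A" "b \<in> A" "c \<in> A" "x \<in> A" "a \<le>\<^sub>R x" "b \<le>\<^sub>R x" "c \<le>\<^sub>R x"
  shows "(a \<sqinter> b) \<sqinter> c = a \<sqinter> (b \<sqinter> c)"
  using PS3[of x a b c] assms by simp

lemma le_R_trans:
  assumes "a \<in> A" "b \<in> A" "c \<in> A" "a \<le>\<^sub>R b" "b \<le>\<^sub>R c"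
  shows "a \<le>\<^sub>R c"
proof -
  have "a = b \<sqinter> (c \<sqinter> a)"
    using PS2[of c b a] assms by simp
  moreover have "c \<sqinter> (b \<sqinter> (c \<sqinter> a)) = b \<sqinter> (c \<sqinter> a)"
    using le_R_assoc[of c b "c \<sqinter> a" c] assms by (simp add: PS1 meet_le_R)
  ultimately show ?thesis
    by simp
qed

lemma le_L_trans: "\<lbrakk>a \<in> A; b \<in> A; c \<in> A; a \<le>\<^sub>L b; b \<le>\<^sub>L c\<rbrakk> \<Longrightarrow> a \<le>\<^sub>L c"
  using pseudosemilattice.le_R_trans[OF dual] by blast

text \<open>The meet \<open>x \<sqinter> y\<close> is the greatest element that is both \<open>\<le>\<^sub>R x\<close> and \<open>\<le>\<^sub>L y\<close>, so that products can be handled by their lower bounds alone.\<close>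

lemma below_meet_iff:
  assumes "e \<in> A" "x \<in> A" "y \<in> A"
  shows "e \<preceq> x \<sqinter> y \<longleftrightarrow> e \<le>\<^sub>R x \<and> e \<le>\<^sub>L y"
proof
  assume "e \<preceq> x \<sqinter> y"
  then show "e \<le>\<^sub>R x \<and> e \<le>\<^sub>L y"
    using le_R_trans[of e "x \<sqinter> y" x] le_L_trans[of e "x \<sqinter> y" y] assms
    by (simp add: meet_le_R meet_le_L)
next
  assume "e \<le>\<^sub>R x \<and> e \<le>\<^sub>L y"
  then show "e \<preceq> x \<sqinter> y"
    using PS2[of x e y] PS2'[of y e x] assms by simp
qed

abbreviation R_rel :: "'a \<Rightarrow> 'a \<Rightarrow> bool"  (infix \<open>\<sim>\<^sub>R\<close> 50) where
  "a \<sim>\<^sub>R b \<equiv> a \<le>\<^sub>R b \<and> b \<le>\<^sub>R a"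

abbreviation L_rel :: "'a \<Rightarrow> 'a \<Rightarrow> bool"  (infix \<open>\<sim>\<^sub>L\<close> 50) where
  "a \<sim>\<^sub>L b \<equiv> a \<le>\<^sub>L b \<and> b \<le>\<^sub>L a"

text \<open>Moving \<open>e\<close> within its \<open>R\<close>-class turns \<open>e \<le>\<^sub>R x\<close> into \<open>e \<preceq> x\<close>, so that a
  one-sided bound amounts to a two-sided bound for another element of the same \<open>D\<close>-class.\<close>

lemma restrict_R:
  assumes "e \<in> A" "x \<in> A" "e \<le>\<^sub>R x"
  shows "e \<sqinter> x \<preceq> x \<and> e \<sim>\<^sub>R e \<sqinter> x"
proof -
  have "(e \<sqinter> x) \<sqinter> e = e"
    using le_R_assoc[of e x e x] assms by (simp add: PS1)
  then show ?thesis
    using assms le_R_trans[of "e \<sqinter> x" e x] by (simp add: meet_le_R meet_le_L)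
qed

lemma restrict_L:
  "\<lbrakk>e \<in> A; x \<in> A; e \<le>\<^sub>L x\<rbrakk> \<Longrightarrow> x \<sqinter> e \<preceq> x \<and> e \<sim>\<^sub>L x \<sqinter> e"
  using pseudosemilattice.restrict_R[OF dual] by blast

lemma R_rel_below_eq:
  assumes "a \<in> A" "b \<in> A" "x \<in> A" "a \<preceq> x" "b \<preceq> x" "a \<sim>\<^sub>R b"
  shows "a = b"
  using PS2[of b a x] assms by simp

text \<open>The equivalence generated by \<open>R\<close> and \<open>L\<close> is generated by their union as a preorder, the
  union being symmetric.\<close>

definition D_rel :: "'a \<Rightarrow> 'a \<Rightarrow> bool"  (infix \<open>\<sim>\<^sub>D\<close> 50) where
  "D_rel = (\<lambda>a b. a \<in> A \<and> b \<in> A \<and> (a \<sim>\<^sub>R b \<or> a \<sim>\<^sub>L b))\<^sup>*\<^sup>*"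

lemma D_refl: "a \<sim>\<^sub>D a"
  by (simp add: D_rel_def)

lemma D_trans: "a \<sim>\<^sub>D b \<Longrightarrow> b \<sim>\<^sub>D c \<Longrightarrow> a \<sim>\<^sub>D c"
  unfolding D_rel_def by (rule rtranclp_trans)

lemma D_sym: "a \<sim>\<^sub>D b \<Longrightarrow> b \<sim>\<^sub>D a"
proof -
  have "symp (\<lambda>a b. a \<in> A \<and> b \<in> A \<and> (a \<sim>\<^sub>R b \<or> a \<sim>\<^sub>L b))"
    by (rule sympI) blast
  then show "a \<sim>\<^sub>D b \<Longrightarrow> b \<sim>\<^sub>D a"
    unfolding D_rel_def by (rule sympD[OF symp_rtranclp])
qed

lemma R_imp_D: "\<lbrakk>a \<in> A; b \<in> A; a \<sim>\<^sub>R b\<rbrakk> \<Longrightarrow> a \<sim>\<^sub>D b"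
  unfolding D_rel_def by (rule r_into_rtranclp) blast

lemma L_imp_D: "\<lbrakk>a \<in> A; b \<in> A; a \<sim>\<^sub>L b\<rbrakk> \<Longrightarrow> a \<sim>\<^sub>D b"
  unfolding D_rel_def by (rule r_into_rtranclp) blast

text \<open>By reflexivity, a sequence of \<open>R\<close>- and \<open>L\<close>-steps can be padded to an alternating one of the
  shape that the alternation of left and right factors in the words \<open>w\<^sub>i\<close> requires.\<close>

lemma D_zigzag:
  assumes "e \<sim>\<^sub>D f" "e \<in> A"
  obtains n :: nat and c where "2 \<le> n" "c 1 = e" "c (2 * n) = f" "range c \<subseteq> A"
    "\<And>i. \<lbrakk>1 \<le> i; i < 2 * n; odd i\<rbrakk> \<Longrightarrow> c i \<sim>\<^sub>L c (i + 1)"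
    "\<And>i. \<lbrakk>1 \<le> i; i < 2 * n; even i\<rbrakk> \<Longrightarrow> c i \<sim>\<^sub>R c (i + 1)"
proof -
  have "\<exists>(n :: nat) c. 2 \<le> n \<and> c 1 = e \<and> c (2 * n) = f \<and> range c \<subseteq> A \<and>
      (\<forall>i. 1 \<le> i \<and> i < 2 * n \<longrightarrow> (if odd i then c i \<sim>\<^sub>L c (i + 1) else c i \<sim>\<^sub>R c (i + 1)))"
    using assms(1) unfolding D_rel_def
  proof (induction rule: rtranclp_induct)
    case base
    show ?case
      using assms(2) by (intro exI[of _ 2] exI[of _ "\<lambda>_. e"]) (auto simp: PS1)
  next
    case (step f g)
    then obtain n :: nat and c where nc: "2 \<le> n" "c 1 = e" "c (2 * n) = f" "range c \<subseteq> A"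
      "\<forall>i. 1 \<le> i \<and> i < 2 * n \<longrightarrow> (if odd i then c i \<sim>\<^sub>L c (i + 1) else c i \<sim>\<^sub>R c (i + 1))"
      by blast
    \<comment> \<open>One step is replaced by an \<open>R\<close>-step followed by an \<open>L\<close>-step, one of which is trivial.\<close>
    define h where "h = (if f \<sim>\<^sub>R g then g else f)"
    define c' where "c' = c(2 * n + 1 := h, 2 * n + 2 := g)"
    have h: "h \<in> A" "f \<sim>\<^sub>R h" "h \<sim>\<^sub>L g"
      using step.hyps(2) by (auto simp: h_def PS1)
    have "2 \<le> n + 1" "c' 1 = e" "c' (2 * (n + 1)) = g"
      using nc(1,2) by (auto simp: c'_def)
    moreover have "range c' \<subseteq> A"
      using nc(4) h step.hyps(2) by (auto simp: c'_def)
    moreover have "if odd i then c' i \<sim>\<^sub>L c' (i + 1) else c' i \<sim>\<^sub>R c' (i + 1)"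
      if i: "1 \<le> i" "i < 2 * (n + 1)" for i
    proof -
      have "i < 2 * n \<or> i = 2 * n \<or> i = 2 * n + 1"
        using i(2) by presburger
      then consider "i < 2 * n" | "i = 2 * n" | "i = 2 * n + 1"
        by blast
      then show ?thesis
      proof cases
        case 1
        then show ?thesis
          using nc(5) i by (auto simp: c'_def)
      qed (use h nc in \<open>auto simp: c'_def\<close>)
    qed
    ultimately show ?case
      by blast
  qed
  then obtain n :: nat and c where nc: "2 \<le> n" "c 1 = e" "c (2 * n) = f" "range c \<subseteq> A"
    "\<forall>i. 1 \<le> i \<and> i < 2 * n \<longrightarrow> (if odd i then c i \<sim>\<^sub>L c (i + 1) else c i \<sim>\<^sub>R c (i + 1))"
    by blast
  show thesis
    by (rule that[OF nc(1-4)]) (use nc(5) in presburger)+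
qed

end

section \<open>Pseudosemilattices satisfying the cycle identities\<close>

locale cyclic_pseudosemilattice = pseudosemilattice +
  assumes word_u_v: "2 \<le> n \<Longrightarrow> range \<rho> \<subseteq> A \<Longrightarrow> eval m \<rho> (word_u n) = eval m \<rho> (word_v n)"
begin

text \<open>Here the identities are used.  Reading the word \<open>w\<^sub>2\<close> along a zigzag
  \<open>e = c\<^sub>1 L c\<^sub>2 R c\<^sub>3 L \<dots> L c\<^bsub>2n\<^esub> = f\<close>, with \<open>c\<^sub>i\<close> substituted for \<open>x\<^sub>i\<close> and \<open>x\<close> for \<open>x\<^sub>1\<close>, keeps
  \<open>c\<^sub>i\<close> below the value of \<open>w\<^sub>i\<close>, starting from \<open>w\<^bsub>2n\<^esub> = x \<sqinter> f = f\<close>.  So \<open>e\<close> is below the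
  value of \<open>u\<^sub>n\<close>, and passing to \<open>v\<^sub>n\<close> replaces the left factor \<open>x\<close> by \<open>f\<close>.\<close>

lemma D_below_le_R:
  assumes "e \<in> A" "x \<in> A" "e \<preceq> x" "f \<preceq> x" "e \<sim>\<^sub>D f"
  shows "e \<le>\<^sub>R f"
proof -
  obtain n :: nat and c
    where n: "2 \<le> n" and c: "c 1 = e" "c (2 * n) = f" "range c \<subseteq> A"
      and odd: "\<And>i. \<lbrakk>1 \<le> i; i < 2 * n; odd i\<rbrakk> \<Longrightarrow> c i \<sim>\<^sub>L c (i + 1)"
      and even: "\<And>i. \<lbrakk>1 \<le> i; i < 2 * n; even i\<rbrakk> \<Longrightarrow> c i \<sim>\<^sub>R c (i + 1)"
    using D_zigzag[OF \<open>e \<sim>\<^sub>D f\<close> \<open>e \<in> A\<close>] by blast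
  define \<rho> where "\<rho> = c(1 := x)"
  have \<rho>: "range \<rho> \<subseteq> A"
    using c \<open>x \<in> A\<close> by (auto simp: \<rho>_def)
  have cA: "c i \<in> A" for i
    using c by auto
  then have fA: "f \<in> A"
    unfolding c(2)[symmetric] .
  have \<rho>_c: "\<rho> i = c i" if "2 \<le> i" for i
    using that by (simp add: \<rho>_def)
  let ?w = "\<lambda>i. eval m \<rho> (word_w n i)"
  have wA: "?w i \<in> A" for i
    by (rule eval_closed[OF \<rho>])
  have "2 \<le> i \<Longrightarrow> c i \<preceq> ?w i" if "i \<le> 2 * n" for i
    using that
  proof (induction rule: inc_induct)
    case base
    have "?w (2 * n) = x \<sqinter> f"
      using n c by (simp add: word_w_last \<rho>_def)
    also have "\<dots> = f"
      using \<open>f \<preceq> x\<close> by (rule conjunct1)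
    finally show ?case
      unfolding c(2) using PS1[OF fA] by simp
  next
    case (step i)
    then have i: "1 \<le> i" "i < 2 * n" and IH: "c (i + 1) \<preceq> ?w (i + 1)"
      by simp_all
    have refl: "c i \<preceq> c i"
      by (intro conjI PS1 cA)
    show ?case
    proof (cases "odd i")
      case True
      have w: "?w i = c i \<sqinter> ?w (i + 1)"
        using True step by (simp add: word_w_odd \<rho>_c)
      have "c i \<le>\<^sub>L ?w (i + 1)"
        by (rule le_L_trans[OF cA cA wA conjunct1[OF odd[OF i True]] conjunct2[OF IH]])
      then show ?thesis
        unfolding w below_meet_iff[OF cA cA wA] by (rule conjI[OF conjunct1[OF refl]])
    next
      case False
      have w: "?w i = ?w (i + 1) \<sqinter> c i"
        using False step by (simp add: word_w_even \<rho>_c)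
      have "c i \<le>\<^sub>R ?w (i + 1)"
        by (rule le_R_trans[OF cA cA wA conjunct1[OF even[OF i]] conjunct1[OF IH]])
          (use False in simp)
      then show ?thesis
        unfolding w below_meet_iff[OF cA wA cA] by (rule conjI[OF _ conjunct2[OF refl]])
    qed
  qed
  from this[of 2] have w2: "c 2 \<preceq> ?w 2"
    using n by simp
  have e_c2: "e \<sim>\<^sub>L c 2"
    using odd[of 1] n unfolding c(1) one_add_one by simp
  have "e \<le>\<^sub>L ?w 2"
    by (rule le_L_trans[OF \<open>e \<in> A\<close> cA wA conjunct1[OF e_c2] conjunct2[OF w2]])
  then have "e \<preceq> x \<sqinter> ?w 2"
    unfolding below_meet_iff[OF \<open>e \<in> A\<close> \<open>x \<in> A\<close> wA] using \<open>e \<preceq> x\<close> by blast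
  also have "x \<sqinter> ?w 2 = (x \<sqinter> f) \<sqinter> ?w 2"
    using word_u_v[OF n \<rho>] n c by (simp add: word_u_def word_v_def \<rho>_def)
  also have "x \<sqinter> f = f"
    using \<open>f \<preceq> x\<close> by (rule conjunct1)
  finally have "e \<preceq> f \<sqinter> ?w 2" .
  then show "e \<le>\<^sub>R f"
    unfolding below_meet_iff[OF \<open>e \<in> A\<close> fA wA] by (rule conjunct1)
qed

lemma D_majorization:
  assumes A: "e \<in> A" "f \<in> A" "x \<in> A" and x: "e \<preceq> x" "f \<preceq> x" and D: "e \<sim>\<^sub>D f"
  shows "e = f"
  by (rule R_rel_below_eq[OF A x])
    (rule conjI D_below_le_R[OF A(1,3) x D] D_below_le_R[OF A(2,3) x(2,1) D_sym[OF D]])+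

text \<open>Restricting both elements to \<open>x\<close> within their \<open>R\<close>-classes makes majorization applicable:
  a one-sided bound \<open>x\<close> singles out at most one \<open>R\<close>-class of a \<open>D\<close>-class.\<close>

lemma D_le_R_imp_R:
  assumes A: "e \<in> A" "f \<in> A" "x \<in> A" and le: "e \<le>\<^sub>R x" "f \<le>\<^sub>R x" and "e \<sim>\<^sub>D f"
  shows "e \<sim>\<^sub>R f"
proof -
  define e' f' where "e' = e \<sqinter> x" and "f' = f \<sqinter> x"
  have A': "e' \<in> A" "f' \<in> A"
    unfolding e'_def f'_def by (rule closed[OF A(1,3)] closed[OF A(2,3)])+
  have e: "e' \<preceq> x" "e \<sim>\<^sub>R e'"
    unfolding e'_def by (rule conjunct1[OF restrict_R[OF A(1,3) le(1)]] conjunct2[OF restrict_R[OF A(1,3) le(1)]])+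
  have f: "f' \<preceq> x" "f \<sim>\<^sub>R f'"
    unfolding f'_def by (rule conjunct1[OF restrict_R[OF A(2,3) le(2)]] conjunct2[OF restrict_R[OF A(2,3) le(2)]])+
  have "e' \<sim>\<^sub>D f'"
    using D_trans[OF D_trans[OF D_sym[OF R_imp_D[OF A(1) A'(1) e(2)]] \<open>e \<sim>\<^sub>D f\<close>]
        R_imp_D[OF A(2) A'(2) f(2)]] .
  then have "e' = f'"
    by (rule D_majorization[OF A' A(3) e(1) f(1)])
  then have e': "e \<sim>\<^sub>R f'"
    using e(2) by (rule subst)
  show ?thesis
    by (intro conjI le_R_trans[OF A(1) A'(2) A(2) conjunct1[OF e'] conjunct2[OF f(2)]]
        le_R_trans[OF A(2) A'(2) A(1) conjunct1[OF f(2)] conjunct2[OF e']])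
qed

lemma D_le_L_imp_L:
  assumes A: "e \<in> A" "f \<in> A" "x \<in> A" and le: "e \<le>\<^sub>L x" "f \<le>\<^sub>L x" and "e \<sim>\<^sub>D f"
  shows "e \<sim>\<^sub>L f"
proof -
  define e' f' where "e' = x \<sqinter> e" and "f' = x \<sqinter> f"
  have A': "e' \<in> A" "f' \<in> A"
    unfolding e'_def f'_def by (rule closed[OF A(3,1)] closed[OF A(3,2)])+
  have e: "e' \<preceq> x" "e \<sim>\<^sub>L e'"
    unfolding e'_def by (rule conjunct1[OF restrict_L[OF A(1,3) le(1)]] conjunct2[OF restrict_L[OF A(1,3) le(1)]])+
  have f: "f' \<preceq> x" "f \<sim>\<^sub>L f'"
    unfolding f'_def by (rule conjunct1[OF restrict_L[OF A(2,3) le(2)]] conjunct2[OF restrict_L[OF A(2,3) le(2)]])+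
  have "e' \<sim>\<^sub>D f'"
    using D_trans[OF D_trans[OF D_sym[OF L_imp_D[OF A(1) A'(1) e(2)]] \<open>e \<sim>\<^sub>D f\<close>]
        L_imp_D[OF A(2) A'(2) f(2)]] .
  then have "e' = f'"
    by (rule D_majorization[OF A' A(3) e(1) f(1)])
  then have e': "e \<sim>\<^sub>L f'"
    using e(2) by (rule subst)
  show ?thesis
    by (intro conjI le_L_trans[OF A(1) A'(2) A(2) conjunct1[OF e'] conjunct2[OF f(2)]]
        le_L_trans[OF A(2) A'(2) A(1) conjunct1[OF f(2)] conjunct2[OF e']])
qed

definition D_meets :: "'a \<Rightarrow> 'a \<Rightarrow> bool" where
  "D_meets e x \<longleftrightarrow> (\<exists>d\<in>A. e \<sim>\<^sub>D d \<and> d \<preceq> x)"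

lemma D_meets_cong: "e \<sim>\<^sub>D f \<Longrightarrow> D_meets e x \<longleftrightarrow> D_meets f x"
  unfolding D_meets_def by (meson D_trans D_sym)

text \<open>This is the analogue of \<open>eval_E2\<close>, with ``the \<open>D\<close>-class of \<open>e\<close> has an element below'' in
  place of ``nonzero''.  From left to right one moves \<open>e\<close> within its \<open>R\<close>- or \<open>L\<close>-class to get
  below the two factors.  From right to left, the induction hypothesis only says that some element
  \<open>f\<close> of the \<open>D\<close>-class is below the left factor; but \<open>e\<close> and \<open>f\<close> are both bounded on the left by
  the value of the first variable, so by majorization they are \<open>R\<close>-equivalent.\<close>

lemma below_eval_iff:
  assumes "range \<rho> \<subseteq> A" "e \<in> A"
  shows "e \<preceq> eval m \<rho> t \<longleftrightarrow>
    e \<preceq> \<rho> (first_var t) \<sqinter> \<rho> (last_var t) \<and> (\<forall>(x, y)\<in>edges t. D_meets e (\<rho> x \<sqinter> \<rho> y))"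
  using assms(2)
proof (induction t arbitrary: e)
  case (Var x)
  have "\<rho> x \<sqinter> \<rho> x = \<rho> x"
    using assms(1) by (intro PS1) auto
  moreover have "e \<preceq> \<rho> x \<Longrightarrow> D_meets e (\<rho> x)"
    using Var D_refl unfolding D_meets_def by blast
  ultimately show ?case
    by auto
next
  case (Meet s t)
  have \<rho>: "\<rho> x \<in> A" for x
    using assms(1) by auto
  have st: "eval m \<rho> s \<in> A" "eval m \<rho> t \<in> A"
    using eval_closed[OF assms(1)] by auto
  note e = \<open>e \<in> A\<close>
  show ?case
  proof
    assume "e \<preceq> eval m \<rho> (s \<curlywedge> t)"
    then have R: "e \<le>\<^sub>R eval m \<rho> s" and L: "e \<le>\<^sub>L eval m \<rho> t"
      using below_meet_iff e st by simp_all
    define f where "f = e \<sqinter> eval m \<rho> s"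
    define g where "g = eval m \<rho> t \<sqinter> e"
    have f: "f \<in> A" "f \<preceq> eval m \<rho> s" "e \<sim>\<^sub>R f"
      using restrict_R[OF e st(1) R] e st by (simp_all add: f_def)
    have g: "g \<in> A" "g \<preceq> eval m \<rho> t" "e \<sim>\<^sub>L g"
      using restrict_L[OF e st(2) L] e st by (simp_all add: g_def)
    have f': "f \<preceq> \<rho> (first_var s) \<sqinter> \<rho> (last_var s)" "\<forall>(x, y)\<in>edges s. D_meets f (\<rho> x \<sqinter> \<rho> y)"
      using Meet.IH(1)[OF f(1)] f(2) by blast+
    have g': "g \<preceq> \<rho> (first_var t) \<sqinter> \<rho> (last_var t)" "\<forall>(x, y)\<in>edges t. D_meets g (\<rho> x \<sqinter> \<rho> y)"
      using Meet.IH(2)[OF g(1)] g(2) by blast+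
    have "e \<le>\<^sub>R \<rho> (first_var s)"
      using f'(1) below_meet_iff[OF f(1) \<rho> \<rho>] le_R_trans[OF e f(1) \<rho>] f(3) by blast
    moreover have "e \<le>\<^sub>L \<rho> (last_var t)"
      using g'(1) below_meet_iff[OF g(1) \<rho> \<rho>] le_L_trans[OF e g(1) \<rho>] g(3) by blast
    ultimately have "e \<preceq> \<rho> (first_var s) \<sqinter> \<rho> (last_var t)"
      using below_meet_iff[OF e \<rho> \<rho>] by blast
    moreover from this have "D_meets e (\<rho> (first_var s) \<sqinter> \<rho> (last_var t))"
      using e D_refl unfolding D_meets_def by blast
    moreover have "D_meets e x \<longleftrightarrow> D_meets f x" "D_meets e x \<longleftrightarrow> D_meets g x" for x
      using D_meets_cong R_imp_D[OF e f(1,3)] L_imp_D[OF e g(1,3)] by blast+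
    ultimately show "e \<preceq> \<rho> (first_var (s \<curlywedge> t)) \<sqinter> \<rho> (last_var (s \<curlywedge> t)) \<and>
        (\<forall>(x, y)\<in>edges (s \<curlywedge> t). D_meets e (\<rho> x \<sqinter> \<rho> y))"
      using f'(2) g'(2) by auto
  next
    assume "e \<preceq> \<rho> (first_var (s \<curlywedge> t)) \<sqinter> \<rho> (last_var (s \<curlywedge> t)) \<and>
        (\<forall>(x, y)\<in>edges (s \<curlywedge> t). D_meets e (\<rho> x \<sqinter> \<rho> y))"
    then have R: "e \<le>\<^sub>R \<rho> (first_var s)" and L: "e \<le>\<^sub>L \<rho> (last_var t)"
      and es: "\<forall>(x, y)\<in>edges s. D_meets e (\<rho> x \<sqinter> \<rho> y)"
      and et: "\<forall>(x, y)\<in>edges t. D_meets e (\<rho> x \<sqinter> \<rho> y)"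
      using below_meet_iff[OF e \<rho> \<rho>] by auto
    obtain f where f: "f \<in> A" "e \<sim>\<^sub>D f" "f \<preceq> \<rho> (first_var s) \<sqinter> \<rho> (last_var s)"
      using es first_last_in_edges[of s] by (auto simp: D_meets_def)
    obtain g where g: "g \<in> A" "e \<sim>\<^sub>D g" "g \<preceq> \<rho> (first_var t) \<sqinter> \<rho> (last_var t)"
      using et first_last_in_edges[of t] by (auto simp: D_meets_def)
    have "f \<preceq> eval m \<rho> s"
      using Meet.IH(1)[OF f(1)] f(3) es D_meets_cong[OF f(2)] by simp
    moreover have "g \<preceq> eval m \<rho> t"
      using Meet.IH(2)[OF g(1)] g(3) et D_meets_cong[OF g(2)] by simp
    moreover have "e \<sim>\<^sub>R f"
      using D_le_R_imp_R[OF e f(1) \<rho> R _ f(2)] f(3) below_meet_iff[OF f(1) \<rho> \<rho>] by blast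
    moreover have "e \<sim>\<^sub>L g"
      using D_le_L_imp_L[OF e g(1) \<rho> L _ g(2)] g(3) below_meet_iff[OF g(1) \<rho> \<rho>] by blast
    ultimately have "e \<le>\<^sub>R eval m \<rho> s \<and> e \<le>\<^sub>L eval m \<rho> t"
      using le_R_trans[OF e f(1) st(1)] le_L_trans[OF e g(1) st(2)] by blast
    then show "e \<preceq> eval m \<rho> (s \<curlywedge> t)"
      using below_meet_iff[OF e st] by simp
  qed
qed

lemma satisfies_E2_identities:
  assumes "satisfies E2 (s, t)"
  shows "satisfies (A, m) (s, t)"
proof -
  have "eval m \<rho> s = eval m \<rho> t" if \<rho>: "range \<rho> \<subseteq> A" for \<rho>
  proof (rule below_antisym)
    have "e \<preceq> eval m \<rho> s \<longleftrightarrow> e \<preceq> eval m \<rho> t" if "e \<in> A" for e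
      using assms unfolding below_eval_iff[OF \<rho> that] E2_satisfies_iff by simp
    moreover have "a \<preceq> a" if "a \<in> A" for a
      using that by (simp add: PS1)
    ultimately show "eval m \<rho> s \<preceq> eval m \<rho> t" "eval m \<rho> t \<preceq> eval m \<rho> s"
      using eval_closed[OF \<rho>] by blast+
  qed
  then show ?thesis
    by (simp add: satisfies_def)
qed

end

section \<open>Strict pseudosemilattices\<close>

lemma equational_class_Un:
  "equational_class (\<Sigma> \<union> \<Sigma>') = equational_class \<Sigma> \<inter> equational_class \<Sigma>'"
  by (auto simp: equational_class_def)

theorem theorem4p9:
  "(SPS :: 'a magma set) = PS \<inter> equational_class {(word_u n, word_v n) | n. 2 \<le> n}"
proof
  let ?U = "{(word_u n, word_v n) | n. 2 \<le> n}"
  have "E2 \<in> equational_class ?U"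
    using E2_closed E2_satisfies_word_u_v by (auto simp: equational_class_def E2_def)
  then have "E2 \<in> equational_class (PS_identities \<union> ?U)"
    using E2_in_PS by (simp add: PS_def equational_class_Un)
  then have "(SPS :: 'a magma set) \<subseteq> equational_class (PS_identities \<union> ?U)"
    unfolding SPS_def generated_variety_def by blast
  then show "(SPS :: 'a magma set) \<subseteq> PS \<inter> equational_class ?U"
    by (simp add: PS_def equational_class_Un)
  show "PS \<inter> equational_class ?U \<subseteq> (SPS :: 'a magma set)"
  proof
    fix M :: "'a magma" assume M: "M \<in> PS \<inter> equational_class ?U"
    obtain A m where [simp]: "M = (A, m)"
      by (cases M)
    interpret pseudosemilattice A m
      using M by (intro pseudosemilattice_if_PS) simp
    interpret cyclic_pseudosemilattice A m
      by unfold_locales (use M in \<open>auto simp: equational_class_def satisfies_def\<close>)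
    show "M \<in> SPS"
      using satisfies_E2_identities
      by (fastforce simp: SPS_def generated_variety_def equational_class_def)
  qed
qed

end
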